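(* Let $0<p_n<n$ with $p_n=o(n)$, let $a>0$ be fixed, let $\tau=(p_n/n)^\alpha$ with a constant $\alpha\ge1$, and let $\omega=\omega_n$ satisfy $(p_n/n)^K\le\omega\le\frac{p_n}{n}\sqrt{\log(n/p_n)}\le\frac12$ for some constant $K>1$. Consider the spike-and-slab Lasso prior, i.e. the scale-mixture-of-normals prior with mixing density $$\pi(u)=\omega a e^{-au}+(1-\omega)\frac1\tau e^{-u/\tau},\quad u>0.$$ Then for every positive sequence $M_n\to\infty$, $$\sup_{\theta_0\in\ell_0[p_n]}\mathbb E_{\theta_0}\Pi\big(\theta:\|\theta-\theta_0\|^2>M_np_n\log(n/p_n)\,\big|\,X^n\big)\to0 \quad\text{and}\quad \sup_{\theta_0\in\ell_0[p_n]}\mathbb E_{\theta_0}\|\widehat\theta-\theta_0\|^2\lesssim p_n\log(n/p_n).$$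
   Context: Model: for each $n$, $X^n=(X_1,\dots,X_n)\sim\mathcal N(\theta_0,I_n)$ with $\theta_0\in\mathbb R^n$; $\mathbb E_{\theta_0}$ is expectation under this law. $\ell_0[p_n]=\{\theta\in\mathbb R^n:\sum_{i=1}^n\mathbf 1\{\theta_i\ne0\}\le p_n\}$. The scale-mixture-of-normals prior with mixing density $\pi$ (a possibly $n$-dependent probability density on $[0,\infty)$): independently for $i=1,\dots,n$, $\theta_i\mid\sigma_i^2\sim\mathcal N(0,\sigma_i^2)$ and $\sigma_i^2\sim\pi$. $\Pi(\cdot\mid X^n)$ is the posterior distribution of $\theta=(\theta_1,\dots,\theta_n)$ when $X^n\mid\theta\sim\mathcal N(\theta,I_n)$, and $\widehat\theta$ is the coordinatewise posterior mean. $\|\cdot\|$ is the Euclidean norm. Limits are as $n\to\infty$; $A_n\lesssim B_n$ means $A_n\le C_0B_n$ for all sufficiently large $n$ with a constant $C_0$ independent of $n$. *)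

theory Defs
  imports "HOL-Probability.Probability" "HOL-Library.Landau_Symbols"
begin

text \<open>
  Vectors in \<open>\<real>\<^sup>n\<close> are the elements of \<open>{1..n} \<rightarrow>\<^sub>E UNIV\<close>, the space of the product
  measures below, because the dimension \<open>n\<close> tends to infinity inside the statement.
\<close>

definition sparse_vectors :: "nat \<Rightarrow> real \<Rightarrow> (nat \<Rightarrow> real) set" where
  "sparse_vectors n s = {\<theta> \<in> {1..n} \<rightarrow>\<^sub>E UNIV. (\<Sum>i\<in>{1..n}. of_bool (\<theta> i \<noteq> 0)) \<le> s}"

definition vec_dist :: "nat \<Rightarrow> (nat \<Rightarrow> real) \<Rightarrow> (nat \<Rightarrow> real) \<Rightarrow> real" where
  "vec_dist n \<theta> \<theta>' = L2_set (\<lambda>i. \<theta> i - \<theta>' i) {1..n}"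

definition obs_law :: "nat \<Rightarrow> (nat \<Rightarrow> real) \<Rightarrow> (nat \<Rightarrow> real) measure" where
  "obs_law n \<theta>0 = (\<Pi>\<^sub>M i\<in>{1..n}. density lborel (\<lambda>x. ennreal (normal_density (\<theta>0 i) 1 x)))"

text \<open>
  The argument \<open>u\<close> of the mixing density is a variance, whereas \<^const>\<open>normal_density\<close> takes
  a standard deviation. The mixing density is understood to vanish on \<open>{..<0}\<close>; the value of
  the kernel at \<open>u = 0\<close> (there \<^const>\<open>normal_density\<close> is zero) concerns a null set only.
\<close>

definition smn_prior1 :: "(real \<Rightarrow> real) \<Rightarrow> real measure" where
  "smn_prior1 \<pi> =
     density lborel (\<lambda>u. ennreal (\<pi> u)) \<bind>
       (\<lambda>u. density lborel (\<lambda>t. ennreal (normal_density 0 (sqrt u) t)))"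

definition smn_prior :: "nat \<Rightarrow> (real \<Rightarrow> real) \<Rightarrow> (nat \<Rightarrow> real) measure" where
  "smn_prior n \<pi> = (\<Pi>\<^sub>M i\<in>{1..n}. smn_prior1 \<pi>)"

definition likelihood :: "nat \<Rightarrow> (nat \<Rightarrow> real) \<Rightarrow> (nat \<Rightarrow> real) \<Rightarrow> ennreal" where
  "likelihood n x \<theta> = ennreal (\<Prod>i\<in>{1..n}. normal_density (\<theta> i) 1 (x i))"

text \<open>The version of the posterior distribution given by Bayes' formula.\<close>

definition posterior :: "nat \<Rightarrow> (real \<Rightarrow> real) \<Rightarrow> (nat \<Rightarrow> real) \<Rightarrow> (nat \<Rightarrow> real) measure" where
  "posterior n \<pi> x =
     density (smn_prior n \<pi>)
       (\<lambda>\<theta>. likelihood n x \<theta> / (\<integral>\<^sup>+\<theta>'. likelihood n x \<theta>' \<partial>smn_prior n \<pi>))"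

definition posterior_mean :: "nat \<Rightarrow> (real \<Rightarrow> real) \<Rightarrow> (nat \<Rightarrow> real) \<Rightarrow> nat \<Rightarrow> real" where
  "posterior_mean n \<pi> x = (\<lambda>i\<in>{1..n}. \<integral>\<theta>. \<theta> i \<partial>posterior n \<pi> x)"

definition ssl_mixing_density :: "real \<Rightarrow> real \<Rightarrow> real \<Rightarrow> real \<Rightarrow> real" where
  "ssl_mixing_density a \<tau> \<omega> u =
     (if 0 < u then \<omega> * a * exp (- a * u) + (1 - \<omega>) * (1 / \<tau>) * exp (- u / \<tau>) else 0)"

end

theory Submission
  imports Defs
begin

text \<open>
  Prior, likelihood and evidence factorise over the coordinates, so the posterior expectation of
  \<open>\<parallel>\<theta> - \<theta>0\<parallel>\<^sup>2\<close> is the sum of one-dimensional posterior risks, each depending on one observation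
  only. It suffices to bound the expectation of this sum by a multiple of \<open>p ln (n / p)\<close>: Markov's
  inequality then gives the contraction statement, and Jensen's inequality (the squared error of a
  mean is at most the mean squared error) gives the statement on the posterior mean.

  Let \<open>\<pi>\<close> be the mixing density and \<open>m\<close> the marginal density of one observation. Integrating out
  the normal variable writes \<open>m\<close> as the \<open>\<pi>\<close>-mixture of the centred normal densities of variance
  \<open>1 + u\<close>. This representation yields both one-dimensional bounds, without closed forms
  for the prior density or for \<open>m\<close>.

  At a zero coordinate (\<open>risk1_at_zero\<close>) the expected risk is at most twice the prior variance
  \<open>v\<close>, the mean of \<open>\<pi>\<close>. When \<open>v \<le> 1\<close> the density \<open>m\<close> is at least half the standard
  normal density \<open>\<phi>\<close>, so the factor \<open>\<phi> / m\<close> which arises from integrating the risk against \<open>\<phi>\<close> is at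
  most \<open>2\<close>; what remains is, by Fubini, the prior second moment. For the spike-and-slab Lasso
  \<open>v \<le> \<omega> / a + \<tau>\<close>, and \<open>n v\<close> has order at most \<open>p ln (n / p)\<close>.

  At an arbitrary coordinate (\<open>risk1_bound\<close>) the posterior of \<open>\<theta> - x\<close> has second moment of order
  \<open>ln (n / p)\<close>, uniformly in the observation \<open>x\<close>. Indeed, multiplying the likelihood by
  \<open>exp ((\<theta> - x)\<^sup>2 / 4)\<close> turns its variance \<open>1\<close> into \<open>2\<close>. In the mixture representation of \<open>m\<close>
  this replaces \<open>\<pi>(u)\<close> by the shifted density \<open>\<pi>(u - 1)\<close>. If \<open>\<pi>(u) \<le> D \<pi>(u + 1)\<close>, the posterior
  expectation of \<open>exp ((\<theta> - x)\<^sup>2 / 4)\<close> is therefore at most \<open>sqrt 2 * D\<close>, and that of \<open>(\<theta> - x)\<^sup>2\<close> at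
  most \<open>4 ln (sqrt 2 * D)\<close>. For the spike-and-slab Lasso the slab alone dominates the
  shifted prior, with \<open>D\<close> of order \<open>1 / (\<omega> \<tau>)\<close>, which is polynomial in \<open>n / p\<close> by the lower bound
  on \<open>\<omega>\<close> and the definition of \<open>\<tau>\<close>; at most \<open>p\<close> coordinates pay this logarithm.
\<close>

section \<open>The prior and the posterior of one coordinate\<close>

lemma nn_integral_normal_density: "0 < s \<Longrightarrow> (\<integral>\<^sup>+t. ennreal (normal_density \<mu> s t) \<partial>lborel) = 1"
  by (simp add: nn_integral_eq_integral)

lemma measurable_normal_density_mean [measurable (raw)]:
  assumes [measurable]: "f \<in> borel_measurable M" "g \<in> borel_measurable M"
  shows "(\<lambda>y. normal_density (f y) s (g y)) \<in> borel_measurable M"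
  unfolding normal_density_def by measurable

locale mixing_density =
  fixes \<pi> :: "real \<Rightarrow> real"
  assumes measurable_mixing [measurable]: "\<pi> \<in> borel_measurable borel"
    and mixing_nonpos: "\<And>u. u \<le> 0 \<Longrightarrow> \<pi> u = 0"
    and mixing_total: "(\<integral>\<^sup>+u. ennreal (\<pi> u) \<partial>lborel) = 1"
begin

lemma measurable_normal_kernel:
  "(\<lambda>u. density lborel (\<lambda>t. ennreal (normal_density 0 (sqrt u) t)))
     \<in> measurable borel (subprob_algebra borel)"
proof (rule measurable_subprob_algebra)
  fix u :: real
  have "(\<integral>\<^sup>+t. ennreal (normal_density 0 (sqrt u) t) \<partial>lborel) \<le> 1"
  proof (cases "u = 0")
    case True
    then show ?thesis by (simp add: normal_density_def)
  next
    case False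
    have "normal_density 0 (sqrt u) = normal_density 0 (sqrt \<bar>u\<bar>)"
      by (cases "0 \<le> u") (simp_all add: normal_density_def fun_eq_iff abs_if real_sqrt_minus)
    moreover have "prob_space (density lborel (normal_density 0 (sqrt \<bar>u\<bar>)))"
      using False by (intro prob_space_normal_density) auto
    ultimately show ?thesis
      using prob_space.emeasure_space_1 by (fastforce simp: emeasure_density)
  qed
  then show "subprob_space (density lborel (\<lambda>t. ennreal (normal_density 0 (sqrt u) t)))"
    by (intro subprob_spaceI) (auto simp: emeasure_density)
next
  fix A :: "real set" assume [measurable]: "A \<in> sets borel"
  have [measurable]: "(\<lambda>(u, t). ennreal (normal_density 0 (sqrt u) t)) \<in> borel_measurable (borel \<Otimes>\<^sub>M borel)"
    unfolding normal_density_def by measurable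
  show "(\<lambda>u. emeasure (density lborel (\<lambda>t. ennreal (normal_density 0 (sqrt u) t))) A)
      \<in> borel_measurable borel"
    by (simp add: emeasure_density)
qed simp

lemma sets_smn_prior1 [measurable_cong, simp]: "sets (smn_prior1 \<pi>) = sets borel"
  unfolding smn_prior1_def by (rule sets_bind) auto

lemma space_smn_prior1 [simp]: "space (smn_prior1 \<pi>) = UNIV"
  using sets_eq_imp_space_eq[OF sets_smn_prior1] by simp

lemma nn_integral_smn_prior1:
  assumes [measurable]: "f \<in> borel_measurable borel"
  shows "(\<integral>\<^sup>+t. f t \<partial>smn_prior1 \<pi>)
    = (\<integral>\<^sup>+u. ennreal (\<pi> u) * (\<integral>\<^sup>+t. ennreal (normal_density 0 (sqrt u) t) * f t \<partial>lborel) \<partial>lborel)"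
proof -
  have K: "(\<lambda>u. density lborel (\<lambda>t. ennreal (normal_density 0 (sqrt u) t)))
     \<in> measurable (density lborel (\<lambda>u. ennreal (\<pi> u))) (subprob_algebra borel)"
    using measurable_normal_kernel by simp
  have [measurable]: "(\<lambda>(u, t). ennreal (normal_density 0 (sqrt u) t)) \<in> borel_measurable (borel \<Otimes>\<^sub>M borel)"
    unfolding normal_density_def by measurable
  show ?thesis
    unfolding smn_prior1_def by (subst nn_integral_bind[OF _ K]) (simp_all add: nn_integral_density)
qed

text \<open>
  On \<open>{..0}\<close> the kernel of the prior is not the normal law of variance \<open>u\<close>; since \<open>\<pi>\<close> vanishes
  there, integrals against \<open>\<pi>\<close> may be computed with \<open>u > 0\<close>.
\<close>

lemma mixing_mult_cong:
  assumes "\<And>u. 0 < u \<Longrightarrow> F u = G u"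
  shows "(\<integral>\<^sup>+u. ennreal (\<pi> u) * F u \<partial>lborel) = (\<integral>\<^sup>+u. ennreal (\<pi> u) * G u \<partial>lborel)"
proof (rule nn_integral_cong)
  fix u show "ennreal (\<pi> u) * F u = ennreal (\<pi> u) * G u"
    using assms[of u] mixing_nonpos[of u] by (cases "0 < u") auto
qed

lemma prob_space_smn_prior1: "prob_space (smn_prior1 \<pi>)"
proof
  have "emeasure (smn_prior1 \<pi>) (space (smn_prior1 \<pi>)) = (\<integral>\<^sup>+t. 1 \<partial>smn_prior1 \<pi>)"
    by simp
  also have "\<dots> = (\<integral>\<^sup>+u. ennreal (\<pi> u) * 1 \<partial>lborel)"
    by (subst nn_integral_smn_prior1, simp, rule mixing_mult_cong)
      (simp add: nn_integral_normal_density)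
  finally show "emeasure (smn_prior1 \<pi>) (space (smn_prior1 \<pi>)) = 1"
    by (simp add: mixing_total)
qed

sublocale prior1: prob_space "smn_prior1 \<pi>"
  by (rule prob_space_smn_prior1)

lemma nn_integral_prior1_normal:
  assumes "0 < s"
  shows "(\<integral>\<^sup>+t. ennreal (normal_density t s x) \<partial>smn_prior1 \<pi>)
    = (\<integral>\<^sup>+u. ennreal (\<pi> u) * ennreal (normal_density 0 (sqrt (s\<^sup>2 + u)) x) \<partial>lborel)"
proof -
  have "(\<integral>\<^sup>+t. ennreal (normal_density 0 (sqrt u) t) * ennreal (normal_density t s x) \<partial>lborel)
      = ennreal (normal_density 0 (sqrt (s\<^sup>2 + u)) x)" if "0 < u" for u
  proof -
    have "(\<integral>\<^sup>+t. ennreal (normal_density 0 (sqrt u) t) * ennreal (normal_density t s x) \<partial>lborel)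
        = (\<integral>\<^sup>+t. ennreal (normal_density 0 s (x - t) * normal_density 0 (sqrt u) t) \<partial>lborel)"
      by (intro nn_integral_cong)
        (simp add: ennreal_mult' [symmetric] normal_density_def mult.commute)
    also have "\<dots> = ennreal (normal_density 0 (sqrt (s\<^sup>2 + (sqrt u)\<^sup>2)) x)"
      using fun_cong[OF conv_normal_density_zero_mean[of s "sqrt u"], of x] assms that by simp
    finally show ?thesis using that by simp
  qed
  then show ?thesis
    by (subst nn_integral_smn_prior1) (auto intro!: mixing_mult_cong)
qed

lemma nn_integral_prior1_square:
  "(\<integral>\<^sup>+t. ennreal (t\<^sup>2) \<partial>smn_prior1 \<pi>) = (\<integral>\<^sup>+u. ennreal (\<pi> u) * ennreal u \<partial>lborel)"
proof -
  have "(\<integral>\<^sup>+t. ennreal (normal_density 0 (sqrt u) t) * ennreal (t\<^sup>2) \<partial>lborel) = ennreal u"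
    if "0 < u" for u
  proof -
    have "has_bochner_integral lborel (\<lambda>t. normal_density 0 (sqrt u) t * t\<^sup>2) u"
      using normal_moment_even[of "sqrt u" 0 1] that by simp
    then have "(\<integral>\<^sup>+t. ennreal (normal_density 0 (sqrt u) t * t\<^sup>2) \<partial>lborel) = ennreal u"
      by (simp add: has_bochner_integral_iff nn_integral_eq_integral)
    then show ?thesis by (simp add: ennreal_mult')
  qed
  then show ?thesis
    by (subst nn_integral_smn_prior1) (auto intro!: mixing_mult_cong)
qed


end

definition evidence1 :: "(real \<Rightarrow> real) \<Rightarrow> real \<Rightarrow> ennreal" where
  "evidence1 \<pi> x = (\<integral>\<^sup>+t. ennreal (normal_density t 1 x) \<partial>smn_prior1 \<pi>)"

definition posterior1 :: "(real \<Rightarrow> real) \<Rightarrow> real \<Rightarrow> real measure" where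
  "posterior1 \<pi> x =
     density (smn_prior1 \<pi>) (\<lambda>t. ennreal (normal_density t 1 x) / evidence1 \<pi> x)"

definition risk1 :: "(real \<Rightarrow> real) \<Rightarrow> real \<Rightarrow> real \<Rightarrow> ennreal" where
  "risk1 \<pi> t x = (\<integral>\<^sup>+s. ennreal ((s - t)\<^sup>2) \<partial>posterior1 \<pi> x)"

context mixing_density
begin

lemma evidence1_mixture:
  "evidence1 \<pi> x = (\<integral>\<^sup>+u. ennreal (\<pi> u) * ennreal (normal_density 0 (sqrt (1 + u)) x) \<partial>lborel)"
  unfolding evidence1_def using nn_integral_prior1_normal[of 1 x] by simp

lemma evidence1_neq_0: "evidence1 \<pi> x \<noteq> 0"
proof
  assume "evidence1 \<pi> x = 0"
  then have "AE t in smn_prior1 \<pi>. ennreal (normal_density t 1 x) = 0"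
    unfolding evidence1_def by (subst (asm) nn_integral_0_iff_AE) auto
  then have "AE t in smn_prior1 \<pi>. False"
    by eventually_elim (use normal_density_pos[of 1] in \<open>force simp: ennreal_eq_0_iff simp flip: not_less\<close>)
  then show False by simp
qed

lemma evidence1_le_1: "evidence1 \<pi> x \<le> 1"
proof -
  have "normal_density t 1 x \<le> 1" for t
  proof -
    have "normal_density t 1 x \<le> 1 / sqrt (2 * pi) * 1"
      unfolding normal_density_def by (intro mult_mono) auto
    also have "\<dots> \<le> 1" using pi_ge_two by simp
    finally show ?thesis .
  qed
  then have "evidence1 \<pi> x \<le> (\<integral>\<^sup>+t. 1 \<partial>smn_prior1 \<pi>)"
    unfolding evidence1_def by (intro nn_integral_mono) (simp add: ennreal_le_1)
  then show ?thesis using prior1.emeasure_space_1 by simp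
qed

lemma evidence1_neq_top: "evidence1 \<pi> x \<noteq> \<top>"
  using evidence1_le_1[of x] by (auto simp: top_unique)

lemma measurable_evidence1 [measurable]: "evidence1 \<pi> \<in> borel_measurable borel"
  unfolding evidence1_def[abs_def] by measurable

lemma nn_integral_posterior1:
  assumes [measurable]: "f \<in> borel_measurable borel"
  shows "(\<integral>\<^sup>+t. f t \<partial>posterior1 \<pi> x)
    = (\<integral>\<^sup>+t. f t * ennreal (normal_density t 1 x) \<partial>smn_prior1 \<pi>) / evidence1 \<pi> x"
proof -
  have "(\<integral>\<^sup>+t. f t \<partial>posterior1 \<pi> x)
      = (\<integral>\<^sup>+t. f t * ennreal (normal_density t 1 x) / evidence1 \<pi> x \<partial>smn_prior1 \<pi>)"
    unfolding posterior1_def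
    by (subst nn_integral_density) (auto simp: ennreal_times_divide mult.commute)
  also have "\<dots> = (\<integral>\<^sup>+t. f t * ennreal (normal_density t 1 x) \<partial>smn_prior1 \<pi>) / evidence1 \<pi> x"
    by (rule nn_integral_divide) measurable
  finally show ?thesis .
qed

lemma posterior1_total: "(\<integral>\<^sup>+t. 1 \<partial>posterior1 \<pi> x) = 1"
  using evidence1_neq_0[of x] evidence1_neq_top[of x]
  by (subst nn_integral_posterior1) (simp_all add: ennreal_divide_self less_top flip: evidence1_def)

lemma measurable_risk1 [measurable]: "risk1 \<pi> t \<in> borel_measurable borel"
proof -
  have "risk1 \<pi> t = (\<lambda>x. (\<integral>\<^sup>+s. ennreal ((s - t)\<^sup>2) * ennreal (normal_density s 1 x) \<partial>smn_prior1 \<pi>)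
      / evidence1 \<pi> x)"
    unfolding risk1_def by (subst nn_integral_posterior1) auto
  then show ?thesis by simp
qed

text \<open>
  A normal density of larger variance is bounded below by \<open>\<phi> / sqrt (1 + u)\<close>, hence by
  \<open>\<phi> (1 - u / 2)\<close>. The linear minorant is negative for large \<open>u\<close> but can be integrated
  against \<open>\<pi>\<close> exactly, which leaves only the mean of \<open>\<pi>\<close>.
\<close>

lemma evidence1_lower_bound:
  assumes "(\<integral>\<^sup>+u. ennreal (\<pi> u) * ennreal u \<partial>lborel) \<le> 1"
  shows "ennreal (normal_density 0 1 x) \<le> 2 * evidence1 \<pi> x"
proof -
  let ?\<phi> = "normal_density 0 1 x"
  have ptw: "?\<phi> \<le> normal_density 0 (sqrt (1 + u)) x + ?\<phi> / 2 * u" if "0 < u" for u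
  proof -
    have "1 - u / 2 \<le> 1 / sqrt (1 + u)"
    proof -
      have "sqrt (1 + u) \<le> 1 + u / 2"
        using that by (intro real_le_lsqrt) (auto simp: power2_eq_square algebra_simps)
      have "(1 - u / 2) * sqrt (1 + u) \<le> 1"
      proof (cases "u \<le> 2")
        case True
        then have "(1 - u / 2) * sqrt (1 + u) \<le> (1 - u / 2) * (1 + u / 2)"
          using \<open>sqrt (1 + u) \<le> 1 + u / 2\<close> by (intro mult_left_mono) auto
        also have "\<dots> \<le> 1" by (simp add: algebra_simps)
        finally show ?thesis .
      next
        case False
        then have "(1 - u / 2) * sqrt (1 + u) \<le> 0" using that by (intro mult_nonpos_nonneg) auto
        then show ?thesis by simp
      qed
      then show ?thesis using that by (simp add: pos_le_divide_eq)
    qed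
    then have "?\<phi> * (1 - u / 2) \<le> ?\<phi> * (1 / sqrt (1 + u))"
      by (intro mult_left_mono) auto
    also have "\<dots> = 1 / sqrt (2 * pi * (1 + u)) * exp (- (x\<^sup>2 / 2))"
      using that by (simp add: normal_density_def real_sqrt_mult)
    also have "x\<^sup>2 / (2 * (1 + u)) \<le> x\<^sup>2 / 2"
      using that by (intro divide_left_mono) auto
    then have "1 / sqrt (2 * pi * (1 + u)) * exp (- (x\<^sup>2 / 2))
        \<le> 1 / sqrt (2 * pi * (1 + u)) * exp (- (x\<^sup>2 / (2 * (1 + u))))"
      using that by (intro mult_left_mono) auto
    also have "\<dots> = normal_density 0 (sqrt (1 + u)) x"
      using that by (simp add: normal_density_def)
    finally show ?thesis by (simp add: algebra_simps)
  qed
  have "ennreal ?\<phi> = (\<integral>\<^sup>+u. ennreal (\<pi> u) * ennreal ?\<phi> \<partial>lborel)"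
    by (subst nn_integral_multc) (auto simp: mixing_total)
  also have "\<dots> \<le> (\<integral>\<^sup>+u. ennreal (\<pi> u) * ennreal (normal_density 0 (sqrt (1 + u)) x)
      + ennreal (?\<phi> / 2) * (ennreal (\<pi> u) * ennreal u) \<partial>lborel)"
  proof (rule nn_integral_mono)
    fix u
    show "ennreal (\<pi> u) * ennreal ?\<phi> \<le> ennreal (\<pi> u) * ennreal (normal_density 0 (sqrt (1 + u)) x)
      + ennreal (?\<phi> / 2) * (ennreal (\<pi> u) * ennreal u)"
    proof (cases "0 < u")
      case True
      have "ennreal ?\<phi> \<le> ennreal (normal_density 0 (sqrt (1 + u)) x + ?\<phi> / 2 * u)"
        using ptw[OF True] by (rule ennreal_leI)
      also have "\<dots> = ennreal (normal_density 0 (sqrt (1 + u)) x) + ennreal (?\<phi> / 2) * ennreal u"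
        using True by (subst ennreal_plus) (auto simp: ennreal_mult'[symmetric])
      finally have "ennreal ?\<phi>
          \<le> ennreal (normal_density 0 (sqrt (1 + u)) x) + ennreal (?\<phi> / 2) * ennreal u" .
      then have "ennreal (\<pi> u) * ennreal ?\<phi>
          \<le> ennreal (\<pi> u) * (ennreal (normal_density 0 (sqrt (1 + u)) x) + ennreal (?\<phi> / 2) * ennreal u)"
        by (rule mult_left_mono) simp
      then show ?thesis by (simp only: distrib_left mult.left_commute)
    qed (simp add: mixing_nonpos)
  qed
  also have "\<dots> = evidence1 \<pi> x + ennreal (?\<phi> / 2) * (\<integral>\<^sup>+u. ennreal (\<pi> u) * ennreal u \<partial>lborel)"
    by (subst nn_integral_add) (auto simp: evidence1_mixture nn_integral_cmult normal_density_def)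
  also have "\<dots> \<le> evidence1 \<pi> x + ennreal (?\<phi> / 2) * 1"
    using assms by (intro add_mono mult_left_mono) auto
  finally have *: "ennreal ?\<phi> \<le> evidence1 \<pi> x + ennreal (?\<phi> / 2)" by simp
  obtain e where e: "0 \<le> e" "evidence1 \<pi> x = ennreal e"
    using evidence1_neq_top[of x] by (cases "evidence1 \<pi> x") auto
  have "?\<phi> \<le> e + ?\<phi> / 2"
    using * e by (simp flip: ennreal_plus)
  then have "?\<phi> \<le> 2 * e" by simp
  then have "ennreal ?\<phi> \<le> ennreal (2 * e)" by (rule ennreal_leI)
  then show ?thesis using e by (simp add: ennreal_mult')
qed

text \<open>
  The posterior density has the evidence in its denominator; the previous bound cancels it against
  the density of the observation, up to a factor \<open>2\<close>.
\<close>

lemma risk1_at_zero: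
  assumes "(\<integral>\<^sup>+u. ennreal (\<pi> u) * ennreal u \<partial>lborel) \<le> 1"
  shows "(\<integral>\<^sup>+x. ennreal (normal_density 0 1 x) * risk1 \<pi> 0 x \<partial>lborel)
    \<le> 2 * (\<integral>\<^sup>+u. ennreal (\<pi> u) * ennreal u \<partial>lborel)"
proof -
  interpret pair_sigma_finite "smn_prior1 \<pi>" "lborel :: real measure" ..
  let ?A = "\<lambda>x. \<integral>\<^sup>+s. ennreal (s\<^sup>2) * ennreal (normal_density s 1 x) \<partial>smn_prior1 \<pi>"
  have "ennreal (normal_density 0 1 x) * risk1 \<pi> 0 x \<le> 2 * ?A x" for x
  proof -
    have "ennreal (normal_density 0 1 x) * risk1 \<pi> 0 x
        = ennreal (normal_density 0 1 x) * (?A x / evidence1 \<pi> x)"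
      unfolding risk1_def by (subst nn_integral_posterior1) auto
    also have "\<dots> \<le> (2 * evidence1 \<pi> x) * (?A x / evidence1 \<pi> x)"
      by (intro mult_right_mono evidence1_lower_bound assms) simp
    also have "\<dots> = (2 * ?A x) * evidence1 \<pi> x / evidence1 \<pi> x"
      by (simp add: ennreal_times_divide ac_simps)
    also have "\<dots> = 2 * ?A x"
      by (rule mult_divide_eq_ennreal[OF evidence1_neq_0 evidence1_neq_top])
    finally show ?thesis .
  qed
  then have "(\<integral>\<^sup>+x. ennreal (normal_density 0 1 x) * risk1 \<pi> 0 x \<partial>lborel) \<le> (\<integral>\<^sup>+x. 2 * ?A x \<partial>lborel)"
    by (rule nn_integral_mono)
  also have "\<dots> = 2 * (\<integral>\<^sup>+x. ?A x \<partial>lborel)"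
    by (rule nn_integral_cmult) measurable
  also have "(\<integral>\<^sup>+x. ?A x \<partial>lborel)
      = (\<integral>\<^sup>+s. \<integral>\<^sup>+x. ennreal (s\<^sup>2) * ennreal (normal_density s 1 x) \<partial>lborel \<partial>smn_prior1 \<pi>)"
    by (rule Fubini') measurable
  also have "\<dots> = (\<integral>\<^sup>+s. ennreal (s\<^sup>2) \<partial>smn_prior1 \<pi>)"
    by (simp add: nn_integral_cmult nn_integral_normal_density)
  finally show ?thesis by (simp add: nn_integral_prior1_square)
qed

text \<open>
  The exponent \<open>1 / 4\<close> doubles the variance of the likelihood, so that the tilted evidence is the
  evidence of the mixing density shifted by exactly \<open>1\<close>.
\<close>

lemma posterior1_exponential_moment:
  assumes D: "0 \<le> D" "\<And>u. 0 < u \<Longrightarrow> \<pi> u \<le> D * \<pi> (u + 1)"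
  shows "(\<integral>\<^sup>+s. ennreal (exp ((s - x)\<^sup>2 / 4)) \<partial>posterior1 \<pi> x) \<le> ennreal (sqrt 2 * D)"
proof -
  have tilt: "exp ((s - x)\<^sup>2 / 4) * normal_density s 1 x = sqrt 2 * normal_density s (sqrt 2) x" for s
    by (simp add: normal_density_def power2_commute[of s] real_sqrt_mult field_simps flip: exp_add)
  have "(\<integral>\<^sup>+s. ennreal (exp ((s - x)\<^sup>2 / 4)) * ennreal (normal_density s 1 x) \<partial>smn_prior1 \<pi>)
      = (\<integral>\<^sup>+s. ennreal (sqrt 2) * ennreal (normal_density s (sqrt 2) x) \<partial>smn_prior1 \<pi>)"
    by (simp only: ennreal_mult'[symmetric] exp_ge_zero real_sqrt_ge_zero tilt zero_le_numeral)
  also have "\<dots> = ennreal (sqrt 2) *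
      (\<integral>\<^sup>+u. ennreal (\<pi> u) * ennreal (normal_density 0 (sqrt (2 + u)) x) \<partial>lborel)"
    by (subst nn_integral_cmult) (auto simp: nn_integral_prior1_normal)
  also have "(\<integral>\<^sup>+u. ennreal (\<pi> u) * ennreal (normal_density 0 (sqrt (2 + u)) x) \<partial>lborel)
      \<le> (\<integral>\<^sup>+u. ennreal D * (ennreal (\<pi> (1 + 1 * u)) * ennreal (normal_density 0 (sqrt (1 + (1 + 1 * u))) x)) \<partial>lborel)"
  proof (rule nn_integral_mono)
    fix u
    show "ennreal (\<pi> u) * ennreal (normal_density 0 (sqrt (2 + u)) x)
      \<le> ennreal D * (ennreal (\<pi> (1 + 1 * u)) * ennreal (normal_density 0 (sqrt (1 + (1 + 1 * u))) x))"
    proof (cases "0 < u")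
      case True
      have "ennreal (\<pi> u) \<le> ennreal D * ennreal (\<pi> (1 + u))"
        using D(2)[OF True] D(1) by (simp add: ennreal_mult'[symmetric] ennreal_leI add.commute)
      then have "ennreal (\<pi> u) * ennreal (normal_density 0 (sqrt (2 + u)) x)
          \<le> ennreal D * ennreal (\<pi> (1 + u)) * ennreal (normal_density 0 (sqrt (2 + u)) x)"
        by (rule mult_right_mono) simp
      then show ?thesis by (simp add: mult.assoc)
    qed (simp add: mixing_nonpos)
  qed
  also have "\<dots> = ennreal D * (\<integral>\<^sup>+u. ennreal (\<pi> (1 + 1 * u)) * ennreal (normal_density 0 (sqrt (1 + (1 + 1 * u))) x) \<partial>lborel)"
    by (rule nn_integral_cmult) (auto simp: normal_density_def)
  also have "(\<integral>\<^sup>+u. ennreal (\<pi> (1 + 1 * u)) * ennreal (normal_density 0 (sqrt (1 + (1 + 1 * u))) x) \<partial>lborel)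
      = evidence1 \<pi> x"
    unfolding evidence1_mixture
    by (subst nn_integral_real_affine[where c = 1 and t = 1]) (auto simp: normal_density_def)
  finally have "(\<integral>\<^sup>+s. ennreal (exp ((s - x)\<^sup>2 / 4)) * ennreal (normal_density s 1 x) \<partial>smn_prior1 \<pi>)
      \<le> ennreal (sqrt 2 * D) * evidence1 \<pi> x"
    using D(1) by (simp add: ennreal_mult' mult.assoc mult_left_mono)
  then have "(\<integral>\<^sup>+s. ennreal (exp ((s - x)\<^sup>2 / 4)) * ennreal (normal_density s 1 x) \<partial>smn_prior1 \<pi>) / evidence1 \<pi> x
      \<le> ennreal (sqrt 2 * D)"
    using evidence1_neq_0[of x] evidence1_neq_top[of x]
    by (metis divide_right_mono_ennreal mult_divide_eq_ennreal)
  then show ?thesis by (subst nn_integral_posterior1) auto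
qed

text \<open>
  Instead of Jensen's inequality for the logarithm, the tangent of \<open>exp\<close> at \<open>ln B\<close> is used:
  \<open>y + 1 \<le> ln B + exp y / B\<close>, integrated with \<open>B\<close> the bound on the exponential moment.
\<close>

lemma posterior1_second_moment:
  assumes D: "1 \<le> D" "\<And>u. 0 < u \<Longrightarrow> \<pi> u \<le> D * \<pi> (u + 1)"
  shows "(\<integral>\<^sup>+s. ennreal ((s - x)\<^sup>2) \<partial>posterior1 \<pi> x) \<le> ennreal (4 * ln (sqrt 2 * D))"
proof -
  define B where "B = sqrt 2 * D"
  have "1 * 1 \<le> sqrt 2 * D" using D by (intro mult_mono) auto
  then have B: "1 \<le> B" by (simp add: B_def)
  have sets: "sets (posterior1 \<pi> x) = sets borel" by (simp add: posterior1_def)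
  note [measurable_cong] = sets
  let ?y = "\<lambda>s. (s - x)\<^sup>2 / 4"
  have ptw: "?y s + 1 \<le> ln B + exp (?y s) / B" for s
    using exp_ge_add_one_self[of "?y s - ln B"] B by (simp add: exp_diff)
  have "(\<integral>\<^sup>+s. ennreal (?y s) \<partial>posterior1 \<pi> x) + 1 = (\<integral>\<^sup>+s. ennreal (?y s) + 1 \<partial>posterior1 \<pi> x)"
    by (subst nn_integral_add) (simp_all add: posterior1_total del: nn_integral_const)
  also have "\<dots> \<le> (\<integral>\<^sup>+s. ennreal (ln B) * 1 + ennreal (1 / B) * ennreal (exp (?y s)) \<partial>posterior1 \<pi> x)"
  proof (rule nn_integral_mono)
    fix s
    have "ennreal (?y s) + 1 = ennreal (?y s + 1)"
      by (subst ennreal_plus) auto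
    also have "\<dots> \<le> ennreal (ln B + 1 / B * exp (?y s))" using ptw[of s] by (intro ennreal_leI) simp
    also have "\<dots> = ennreal (ln B) * 1 + ennreal (1 / B) * ennreal (exp (?y s))"
      using B by (subst ennreal_plus) (auto simp: ennreal_mult'[symmetric])
    finally show "ennreal (?y s) + 1 \<le> ennreal (ln B) * 1 + ennreal (1 / B) * ennreal (exp (?y s))" .
  qed
  also have "\<dots> = ennreal (ln B) * (\<integral>\<^sup>+s. 1 \<partial>posterior1 \<pi> x)
      + ennreal (1 / B) * (\<integral>\<^sup>+s. ennreal (exp (?y s)) \<partial>posterior1 \<pi> x)"
    by (subst nn_integral_add) (simp_all add: nn_integral_cmult)
  also have "\<dots> \<le> ennreal (ln B) * 1 + ennreal (1 / B) * ennreal B"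
    using posterior1_exponential_moment[OF _ D(2), of x] D(1)
    by (intro add_mono mult_left_mono) (auto simp: posterior1_total B_def simp del: nn_integral_const)
  also have "\<dots> = ennreal (ln B) + 1"
    using B by (simp add: ennreal_mult'[symmetric])
  finally have *: "(\<integral>\<^sup>+s. ennreal (?y s) \<partial>posterior1 \<pi> x) \<le> ennreal (ln B)"
    by simp
  have "(\<integral>\<^sup>+s. ennreal ((s - x)\<^sup>2) \<partial>posterior1 \<pi> x) = (\<integral>\<^sup>+s. 4 * ennreal (?y s) \<partial>posterior1 \<pi> x)"
    by (intro nn_integral_cong) (simp add: ennreal_mult'[symmetric] flip: ennreal_numeral)
  also have "\<dots> = 4 * (\<integral>\<^sup>+s. ennreal (?y s) \<partial>posterior1 \<pi> x)"
    by (rule nn_integral_cmult) measurable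
  also have "\<dots> \<le> 4 * ennreal (ln B)" by (intro mult_left_mono *) simp
  also have "\<dots> = ennreal (4 * ln B)" by (simp add: ennreal_mult')
  finally show ?thesis by (simp add: B_def)
qed

lemma risk1_bound:
  assumes D: "1 \<le> D" "\<And>u. 0 < u \<Longrightarrow> \<pi> u \<le> D * \<pi> (u + 1)"
  shows "(\<integral>\<^sup>+x. ennreal (normal_density t 1 x) * risk1 \<pi> t x \<partial>lborel)
    \<le> ennreal (8 * ln (sqrt 2 * D) + 2)"
proof -
  have "1 * 1 \<le> sqrt 2 * D" using D by (intro mult_mono) auto
  then have B: "0 \<le> ln (sqrt 2 * D)" by simp
  have risk: "risk1 \<pi> t x \<le> ennreal (8 * ln (sqrt 2 * D)) + 2 * ennreal ((x - t)\<^sup>2)" for x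
  proof -
    have [measurable_cong]: "sets (posterior1 \<pi> x) = sets borel" by (simp add: posterior1_def)
    have "(s - t)\<^sup>2 \<le> 2 * (s - x)\<^sup>2 + 2 * (x - t)\<^sup>2" for s
      using zero_le_power2[of "(s - x) - (x - t)"] by (simp add: power2_eq_square algebra_simps)
    then have "risk1 \<pi> t x \<le> (\<integral>\<^sup>+s. ennreal (2 * (s - x)\<^sup>2 + 2 * (x - t)\<^sup>2) \<partial>posterior1 \<pi> x)"
      unfolding risk1_def by (intro nn_integral_mono ennreal_leI)
    also have "\<dots> = (\<integral>\<^sup>+s. 2 * ennreal ((s - x)\<^sup>2) + 2 * ennreal ((x - t)\<^sup>2) * 1 \<partial>posterior1 \<pi> x)"
      by (simp add: ennreal_plus ennreal_mult')
    also have "\<dots> = 2 * (\<integral>\<^sup>+s. ennreal ((s - x)\<^sup>2) \<partial>posterior1 \<pi> x)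
        + 2 * ennreal ((x - t)\<^sup>2) * (\<integral>\<^sup>+s. 1 \<partial>posterior1 \<pi> x)"
      by (subst nn_integral_add) (simp_all add: nn_integral_cmult)
    also have "\<dots> = 2 * (\<integral>\<^sup>+s. ennreal ((s - x)\<^sup>2) \<partial>posterior1 \<pi> x) + 2 * ennreal ((x - t)\<^sup>2)"
      by (simp only: posterior1_total mult_1_right)
    also have "\<dots> \<le> 2 * ennreal (4 * ln (sqrt 2 * D)) + 2 * ennreal ((x - t)\<^sup>2)"
      by (intro add_mono mult_left_mono posterior1_second_moment D order_refl) auto
    also have "2 * ennreal (4 * ln (sqrt 2 * D)) = ennreal (8 * ln (sqrt 2 * D))"
      using B by (simp add: ennreal_mult'[symmetric] flip: ennreal_numeral)
    finally show ?thesis .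
  qed
  have var: "(\<integral>\<^sup>+x. ennreal (normal_density t 1 x) * ennreal ((x - t)\<^sup>2) \<partial>lborel) = 1"
  proof -
    have "has_bochner_integral lborel (\<lambda>x. normal_density t 1 x * (x - t)\<^sup>2) 1"
      using normal_moment_even[of 1 t 1] by simp
    then have "(\<integral>\<^sup>+x. ennreal (normal_density t 1 x * (x - t)\<^sup>2) \<partial>lborel) = ennreal 1"
      by (simp add: has_bochner_integral_iff nn_integral_eq_integral)
    then show ?thesis by (simp add: ennreal_mult')
  qed
  have "(\<integral>\<^sup>+x. ennreal (normal_density t 1 x) * risk1 \<pi> t x \<partial>lborel)
      \<le> (\<integral>\<^sup>+x. ennreal (normal_density t 1 x) * (ennreal (8 * ln (sqrt 2 * D)) + 2 * ennreal ((x - t)\<^sup>2)) \<partial>lborel)"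
    by (intro nn_integral_mono mult_left_mono risk) simp
  also have "\<dots> = (\<integral>\<^sup>+x. ennreal (8 * ln (sqrt 2 * D)) * ennreal (normal_density t 1 x)
      + 2 * (ennreal (normal_density t 1 x) * ennreal ((x - t)\<^sup>2)) \<partial>lborel)"
    by (simp only: distrib_left mult.commute mult.left_commute)
  also have "\<dots> = ennreal (8 * ln (sqrt 2 * D)) + 2"
    by (subst nn_integral_add)
      (simp_all add: nn_integral_cmult nn_integral_normal_density var)
  also have "\<dots> = ennreal (8 * ln (sqrt 2 * D) + 2)"
    using B by (subst ennreal_plus) auto
  finally show ?thesis .
qed

end

section \<open>Product structure in dimension n\<close>

lemma (in prob_space) square_expectation_minus_le:
  fixes f :: "'a \<Rightarrow> real"
  assumes [measurable]: "f \<in> borel_measurable M"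
  shows "ennreal (((\<integral>x. f x \<partial>M) - t)\<^sup>2) \<le> (\<integral>\<^sup>+x. ennreal ((f x - t)\<^sup>2) \<partial>M)"
proof (cases "(\<integral>\<^sup>+x. ennreal ((f x - t)\<^sup>2) \<partial>M) < \<infinity>")
  case True
  then have sq: "integrable M (\<lambda>x. (f x - t)\<^sup>2)"
    by (intro integrableI_nonneg) auto
  then have int: "integrable M (\<lambda>x. f x - t)"
    by (rule square_integrable_imp_integrable[rotated]) simp
  then have "integrable M (\<lambda>x. (f x - t) + t)" by (rule Bochner_Integration.integrable_add) simp
  then have "integrable M f" by simp
  then have "(\<integral>x. f x \<partial>M) - t = expectation (\<lambda>x. f x - t)" by (simp add: prob_space)
  moreover have "(expectation (\<lambda>x. f x - t))\<^sup>2 \<le> expectation (\<lambda>x. (f x - t)\<^sup>2)"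
    using variance_positive[of "\<lambda>x. f x - t"] variance_eq[OF int sq] by simp
  moreover have "(\<integral>\<^sup>+x. ennreal ((f x - t)\<^sup>2) \<partial>M) = ennreal (expectation (\<lambda>x. (f x - t)\<^sup>2))"
    using sq by (intro nn_integral_eq_integral) auto
  ultimately show ?thesis by (simp add: ennreal_leI)
qed (simp add: not_less top_unique)

lemma vec_dist_square: "(vec_dist n \<theta> \<theta>')\<^sup>2 = (\<Sum>i\<in>{1..n}. (\<theta> i - \<theta>' i)\<^sup>2)"
  unfolding vec_dist_def L2_set_def by (simp add: sum_nonneg)

lemma nn_integral_obs_law_component:
  assumes "i \<in> {1..n}" and [measurable]: "f \<in> borel_measurable borel"
  shows "(\<integral>\<^sup>+x. f (x i) \<partial>obs_law n \<theta>0)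
    = (\<integral>\<^sup>+y. ennreal (normal_density (\<theta>0 i) 1 y) * f y \<partial>lborel)"
proof -
  let ?M = "\<lambda>i. density lborel (\<lambda>y. ennreal (normal_density (\<theta>0 i) 1 y))"
  have "(\<integral>\<^sup>+x. f (x i) \<partial>obs_law n \<theta>0) = (\<integral>\<^sup>+y. f y \<partial>distr (Pi\<^sub>M {1..n} ?M) (?M i) (\<lambda>x. x i))"
    unfolding obs_law_def using assms(1) by (subst nn_integral_distr) auto
  also have "distr (Pi\<^sub>M {1..n} ?M) (?M i) (\<lambda>x. x i) = ?M i"
    using assms(1) by (intro distr_PiM_component prob_space_normal_density) auto
  finally show ?thesis by (simp add: nn_integral_density)
qed

context mixing_density
begin

lemma sets_posterior [measurable_cong]: "sets (posterior n \<pi> x) = sets (Pi\<^sub>M {1..n} (\<lambda>_. borel))"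
  unfolding posterior_def smn_prior_def by (simp cong: sets_PiM_cong)

text \<open>
  Prior and likelihood are products, so all factors with index other than \<open>i\<close> cancel against the
  evidence: the marginals of the posterior are the one-dimensional posteriors.
\<close>

lemma nn_integral_posterior_component:
  assumes i: "i \<in> {1..n}" and [measurable]: "f \<in> borel_measurable borel"
  shows "(\<integral>\<^sup>+\<theta>. f (\<theta> i) \<partial>posterior n \<pi> x) = (\<integral>\<^sup>+t. f t \<partial>posterior1 \<pi> (x i))"
proof -
  interpret P: product_sigma_finite "\<lambda>_. smn_prior1 \<pi>" ..
  have [measurable_cong]: "sets (smn_prior n \<pi>) = sets (Pi\<^sub>M {1..n} (\<lambda>_. borel))"
    unfolding smn_prior_def by (simp cong: sets_PiM_cong)
  have lik: "likelihood n x \<theta> = (\<Prod>j\<in>{1..n}. ennreal (normal_density (\<theta> j) 1 (x j)))" for \<theta>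
    by (simp add: likelihood_def prod_ennreal)
  have [measurable]: "likelihood n x \<in> borel_measurable (smn_prior n \<pi>)"
    unfolding lik[abs_def] by measurable
  let ?Z = "\<Prod>j\<in>{1..n}. evidence1 \<pi> (x j)"
  have Z: "(\<integral>\<^sup>+\<theta>. likelihood n x \<theta> \<partial>smn_prior n \<pi>) = ?Z"
    unfolding lik smn_prior_def evidence1_def
    by (subst P.product_nn_integral_prod) auto
  obtain e where e: "\<And>y. evidence1 \<pi> y = ennreal (e y)" "\<And>y. 0 < e y"
  proof
    show "evidence1 \<pi> y = ennreal (enn2real (evidence1 \<pi> y))" for y
      using evidence1_neq_top[of y] by (simp add: less_top)
    show "0 < enn2real (evidence1 \<pi> y)" for y
      using evidence1_neq_top[of y] evidence1_neq_0[of y]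
      by (simp add: enn2real_positive_iff less_top zero_less_iff_neq_zero)
  qed
  define q where "q = (\<Prod>j\<in>{1..n}. e (x j))"
  have "?Z = ennreal q"
    unfolding e(1) q_def by (rule prod_ennreal) (use e(2) in \<open>auto intro: less_imp_le\<close>)
  moreover have "0 < q" unfolding q_def by (intro prod_pos) (use e(2) in auto)
  ultimately have Z_neq: "?Z \<noteq> 0" "?Z \<noteq> \<top>" by simp_all
  define I where "I = (\<integral>\<^sup>+t. f t \<partial>posterior1 \<pi> (x i))"
  let ?g = "\<lambda>j t. (if j = i then f t else 1) * ennreal (normal_density t 1 (x j))"
  have g: "(\<integral>\<^sup>+t. ?g j t \<partial>smn_prior1 \<pi>) = (if j = i then I else 1) * evidence1 \<pi> (x j)" for j
  proof (cases "j = i")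
    case True
    have "I * evidence1 \<pi> (x i) = (\<integral>\<^sup>+t. f t * ennreal (normal_density t 1 (x i)) \<partial>smn_prior1 \<pi>)"
      unfolding I_def using evidence1_neq_0[of "x i"] evidence1_neq_top[of "x i"]
      by (subst nn_integral_posterior1) (auto simp: ennreal_divide_times ennreal_divide_self less_top)
    then show ?thesis using True by simp
  next
    case False
    then show ?thesis by (simp add: evidence1_def)
  qed
  have "(\<integral>\<^sup>+\<theta>. f (\<theta> i) \<partial>posterior n \<pi> x)
      = (\<integral>\<^sup>+\<theta>. (f (\<theta> i) * likelihood n x \<theta>) / ?Z \<partial>smn_prior n \<pi>)"
    unfolding posterior_def Z using i
    by (subst nn_integral_density) (auto simp: ennreal_times_divide mult.commute)
  also have "\<dots> = (\<integral>\<^sup>+\<theta>. f (\<theta> i) * likelihood n x \<theta> \<partial>smn_prior n \<pi>) / ?Z"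
    using i by (intro nn_integral_divide) measurable
  also have "(\<integral>\<^sup>+\<theta>. f (\<theta> i) * likelihood n x \<theta> \<partial>smn_prior n \<pi>)
      = (\<integral>\<^sup>+\<theta>. (\<Prod>j\<in>{1..n}. ?g j (\<theta> j)) \<partial>Pi\<^sub>M {1..n} (\<lambda>_. smn_prior1 \<pi>))"
    unfolding lik smn_prior_def prod.distrib
    using i by (intro nn_integral_cong) (simp add: prod.delta)
  also have "\<dots> = (\<Prod>j\<in>{1..n}. \<integral>\<^sup>+t. ?g j t \<partial>smn_prior1 \<pi>)"
    by (rule P.product_nn_integral_prod) auto
  also have "\<dots> = I * ?Z"
    unfolding g prod.distrib using i by (simp add: prod.delta)
  also have "I * ?Z / ?Z = I"
    by (rule mult_divide_eq_ennreal[OF Z_neq])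
  finally show ?thesis by (simp add: I_def)
qed

lemma prob_space_posterior:
  assumes "1 \<le> n"
  shows "prob_space (posterior n \<pi> x)"
proof
  have "emeasure (posterior n \<pi> x) (space (posterior n \<pi> x)) = (\<integral>\<^sup>+\<theta>. 1 \<partial>posterior n \<pi> x)"
    by simp
  also have "\<dots> = (\<integral>\<^sup>+t. 1 \<partial>posterior1 \<pi> (x 1))"
    using assms by (intro nn_integral_posterior_component) auto
  finally show "emeasure (posterior n \<pi> x) (space (posterior n \<pi> x)) = 1"
    by (simp only: posterior1_total)
qed

lemma posterior_square_loss:
  "(\<integral>\<^sup>+\<theta>. ennreal ((vec_dist n \<theta> \<theta>0)\<^sup>2) \<partial>posterior n \<pi> x) = (\<Sum>i\<in>{1..n}. risk1 \<pi> (\<theta>0 i) (x i))"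
proof -
  have "(\<integral>\<^sup>+\<theta>. ennreal ((vec_dist n \<theta> \<theta>0)\<^sup>2) \<partial>posterior n \<pi> x)
      = (\<integral>\<^sup>+\<theta>. (\<Sum>i\<in>{1..n}. ennreal ((\<theta> i - \<theta>0 i)\<^sup>2)) \<partial>posterior n \<pi> x)"
    by (simp add: vec_dist_square sum_ennreal)
  also have "\<dots> = (\<Sum>i\<in>{1..n}. \<integral>\<^sup>+\<theta>. ennreal ((\<theta> i - \<theta>0 i)\<^sup>2) \<partial>posterior n \<pi> x)"
    by (rule nn_integral_sum) measurable
  also have "\<dots> = (\<Sum>i\<in>{1..n}. risk1 \<pi> (\<theta>0 i) (x i))"
    unfolding risk1_def
    by (intro sum.cong refl nn_integral_posterior_component[where f = "\<lambda>s. ennreal ((s - \<theta>0 _)\<^sup>2)"]) auto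
  finally show ?thesis .
qed

lemma posterior_mean_square_loss:
  assumes "1 \<le> n"
  shows "ennreal ((vec_dist n (posterior_mean n \<pi> x) \<theta>0)\<^sup>2) \<le> (\<Sum>i\<in>{1..n}. risk1 \<pi> (\<theta>0 i) (x i))"
proof -
  interpret prob_space "posterior n \<pi> x" by (rule prob_space_posterior[OF assms])
  have "ennreal ((vec_dist n (posterior_mean n \<pi> x) \<theta>0)\<^sup>2)
      = (\<Sum>i\<in>{1..n}. ennreal (((\<integral>\<theta>. \<theta> i \<partial>posterior n \<pi> x) - \<theta>0 i)\<^sup>2))"
    by (simp add: vec_dist_square posterior_mean_def sum_ennreal)
  also have "\<dots> \<le> (\<Sum>i\<in>{1..n}. \<integral>\<^sup>+\<theta>. ennreal ((\<theta> i - \<theta>0 i)\<^sup>2) \<partial>posterior n \<pi> x)"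
    by (intro sum_mono square_expectation_minus_le) measurable
  also have "\<dots> = (\<Sum>i\<in>{1..n}. risk1 \<pi> (\<theta>0 i) (x i))"
    unfolding risk1_def
    by (intro sum.cong refl nn_integral_posterior_component[where f = "\<lambda>s. ennreal ((s - \<theta>0 _)\<^sup>2)"]) auto
  finally show ?thesis .
qed

lemma posterior_tail_bound:
  assumes "0 < c"
  shows "emeasure (posterior n \<pi> x) {\<theta> \<in> space (posterior n \<pi> x). (vec_dist n \<theta> \<theta>0)\<^sup>2 > c}
    \<le> ennreal (1 / c) * (\<Sum>i\<in>{1..n}. risk1 \<pi> (\<theta>0 i) (x i))"
proof -
  have [measurable]: "(\<lambda>\<theta>. (vec_dist n \<theta> \<theta>0)\<^sup>2) \<in> borel_measurable (posterior n \<pi> x)"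
    unfolding vec_dist_square by measurable
  let ?P = "posterior n \<pi> x"
  let ?u = "\<lambda>\<theta>. ennreal ((vec_dist n \<theta> \<theta>0)\<^sup>2)"
  have "emeasure ?P {\<theta> \<in> space ?P. (vec_dist n \<theta> \<theta>0)\<^sup>2 > c}
      \<le> emeasure ?P {\<theta> \<in> space ?P. 1 \<le> ennreal (1 / c) * ?u \<theta>}"
    using assms by (intro emeasure_mono) (auto simp: ennreal_mult'[symmetric] field_simps)
  also have "\<dots> \<le> ennreal (1 / c) * (\<integral>\<^sup>+\<theta>. ?u \<theta> * indicator (space ?P) \<theta> \<partial>?P)"
    by (rule nn_integral_Markov_inequality) auto
  also have "(\<integral>\<^sup>+\<theta>. ?u \<theta> * indicator (space ?P) \<theta> \<partial>?P) = (\<integral>\<^sup>+\<theta>. ?u \<theta> \<partial>?P)"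
    by (intro nn_integral_cong) simp
  finally show ?thesis by (simp only: posterior_square_loss)
qed

lemma measurable_risk1_component [measurable]:
  "i \<in> {1..n} \<Longrightarrow> (\<lambda>x. risk1 \<pi> t (x i)) \<in> borel_measurable (obs_law n \<theta>0)"
  unfolding obs_law_def by measurable

lemma sparse_risk:
  assumes v: "(\<integral>\<^sup>+u. ennreal (\<pi> u) * ennreal u \<partial>lborel) \<le> ennreal v" "0 \<le> v" "v \<le> 1"
    and D: "1 \<le> D" "\<And>u. 0 < u \<Longrightarrow> \<pi> u \<le> D * \<pi> (u + 1)"
    and sparse: "\<theta>0 \<in> sparse_vectors n s"
  shows "(\<integral>\<^sup>+x. (\<Sum>i\<in>{1..n}. risk1 \<pi> (\<theta>0 i) (x i)) \<partial>obs_law n \<theta>0)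
    \<le> ennreal (2 * real n * v + s * (8 * ln (sqrt 2 * D) + 2))"
proof -
  define R where "R = 8 * ln (sqrt 2 * D) + 2"
  have "1 * 1 \<le> sqrt 2 * D" using D by (intro mult_mono) auto
  then have R: "0 \<le> R" by (simp add: R_def)
  have card: "(\<Sum>i\<in>{1..n}. of_bool (\<theta>0 i \<noteq> 0)) \<le> s"
    using sparse by (simp add: sparse_vectors_def)
  have "(\<integral>\<^sup>+x. (\<Sum>i\<in>{1..n}. risk1 \<pi> (\<theta>0 i) (x i)) \<partial>obs_law n \<theta>0)
      = (\<Sum>i\<in>{1..n}. \<integral>\<^sup>+x. risk1 \<pi> (\<theta>0 i) (x i) \<partial>obs_law n \<theta>0)"
    by (rule nn_integral_sum) measurable
  also have "\<dots> = (\<Sum>i\<in>{1..n}. \<integral>\<^sup>+y. ennreal (normal_density (\<theta>0 i) 1 y) * risk1 \<pi> (\<theta>0 i) y \<partial>lborel)"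
    by (intro sum.cong refl nn_integral_obs_law_component) auto
  also have "\<dots> \<le> (\<Sum>i\<in>{1..n}. ennreal (2 * v + of_bool (\<theta>0 i \<noteq> 0) * R))"
  proof (rule sum_mono)
    fix i
    show "(\<integral>\<^sup>+y. ennreal (normal_density (\<theta>0 i) 1 y) * risk1 \<pi> (\<theta>0 i) y \<partial>lborel)
        \<le> ennreal (2 * v + of_bool (\<theta>0 i \<noteq> 0) * R)"
    proof (cases "\<theta>0 i = 0")
      case True
      have "(\<integral>\<^sup>+u. ennreal (\<pi> u) * ennreal u \<partial>lborel) \<le> 1"
        using v(1,3) by (meson ennreal_le_1 order_trans)
      then have "(\<integral>\<^sup>+y. ennreal (normal_density 0 1 y) * risk1 \<pi> 0 y \<partial>lborel) \<le> 2 * ennreal v"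
        by (intro order_trans[OF risk1_at_zero] mult_left_mono v) auto
      then show ?thesis using True v by (simp add: ennreal_mult')
    next
      case False
      have "(\<integral>\<^sup>+y. ennreal (normal_density (\<theta>0 i) 1 y) * risk1 \<pi> (\<theta>0 i) y \<partial>lborel) \<le> ennreal R"
        unfolding R_def by (rule risk1_bound[OF D])
      also have "\<dots> \<le> ennreal (2 * v + of_bool (\<theta>0 i \<noteq> 0) * R)"
        using False v by (intro ennreal_leI) simp
      finally show ?thesis .
    qed
  qed
  also have "\<dots> = ennreal (\<Sum>i\<in>{1..n}. 2 * v + of_bool (\<theta>0 i \<noteq> 0) * R)"
    using v R by (intro sum_ennreal) auto
  also have "(\<Sum>i\<in>{1..n}. 2 * v + of_bool (\<theta>0 i \<noteq> 0) * R)
      = 2 * real n * v + (\<Sum>i\<in>{1..n}. of_bool (\<theta>0 i \<noteq> 0)) * R"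
    by (simp add: sum.distrib sum_distrib_right)
  also have "ennreal \<dots> \<le> ennreal (2 * real n * v + s * R)"
    using card R by (intro ennreal_leI add_left_mono mult_right_mono)
  finally show ?thesis by (simp add: R_def)
qed

end

section \<open>The spike-and-slab Lasso mixing density\<close>

lemma ssl_moment:
  assumes "0 < a" "0 < \<tau>" "0 \<le> \<omega>" "\<omega> \<le> 1"
  shows "(\<integral>\<^sup>+u. ennreal (ssl_mixing_density a \<tau> \<omega> u) * ennreal (u ^ k) \<partial>lborel)
    = ennreal (\<omega> * (fact k / a ^ k) + (1 - \<omega>) * (fact k * \<tau> ^ k))"
proof -
  have "AE u in lborel. ennreal (ssl_mixing_density a \<tau> \<omega> u) * ennreal (u ^ k)
     = ennreal \<omega> * ennreal (erlang_density 0 a u * u ^ k)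
       + ennreal (1 - \<omega>) * ennreal (erlang_density 0 (1 / \<tau>) u * u ^ k)"
    using AE_lborel_singleton[of 0]
  proof eventually_elim
    case (elim u)
    show ?case
    proof (cases "0 < u")
      case True
      have "ssl_mixing_density a \<tau> \<omega> u * u ^ k
        = \<omega> * (erlang_density 0 a u * u ^ k) + (1 - \<omega>) * (erlang_density 0 (1 / \<tau>) u * u ^ k)"
        using True by (simp add: ssl_mixing_density_def exponential_density_def algebra_simps)
      moreover have "0 \<le> erlang_density 0 a u * u ^ k" "0 \<le> erlang_density 0 (1 / \<tau>) u * u ^ k"
        using True assms by (auto intro!: mult_nonneg_nonneg erlang_density_nonneg)
      ultimately show ?thesis using assms True
        by (simp add: ennreal_mult'[symmetric] ennreal_mult''[symmetric] flip: ennreal_plus)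
    next
      case False
      then show ?thesis using elim
        by (simp add: ssl_mixing_density_def exponential_density_def)
    qed
  qed
  then have "(\<integral>\<^sup>+u. ennreal (ssl_mixing_density a \<tau> \<omega> u) * ennreal (u ^ k) \<partial>lborel)
     = (\<integral>\<^sup>+u. ennreal \<omega> * ennreal (erlang_density 0 a u * u ^ k)
       + ennreal (1 - \<omega>) * ennreal (erlang_density 0 (1 / \<tau>) u * u ^ k) \<partial>lborel)"
    by (rule nn_integral_cong_AE)
  also have "\<dots> = ennreal \<omega> * ennreal (fact k / a ^ k) + ennreal (1 - \<omega>) * ennreal (fact k / (1 / \<tau>) ^ k)"
    using assms nn_integral_erlang_ith_moment[of a 0 k] nn_integral_erlang_ith_moment[of "1 / \<tau>" 0 k]
    by (subst nn_integral_add) (auto simp: nn_integral_cmult)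
  also have "\<dots> = ennreal (\<omega> * (fact k / a ^ k) + (1 - \<omega>) * (fact k * \<tau> ^ k))"
    using assms by (simp add: ennreal_mult'[symmetric] power_one_over flip: ennreal_plus)
  finally show ?thesis .
qed

lemma mixing_density_ssl:
  assumes "0 < a" "0 < \<tau>" "0 \<le> \<omega>" "\<omega> \<le> 1"
  shows "mixing_density (ssl_mixing_density a \<tau> \<omega>)"
proof
  show "ssl_mixing_density a \<tau> \<omega> \<in> borel_measurable borel"
    unfolding ssl_mixing_density_def by measurable
  show "(\<integral>\<^sup>+u. ennreal (ssl_mixing_density a \<tau> \<omega> u) \<partial>lborel) = 1"
    using ssl_moment[OF assms, of 0] by simp
qed (simp add: ssl_mixing_density_def)

text \<open>
  When \<open>a \<le> 1 / \<tau>\<close>, the spike at \<open>u\<close> is at most \<open>exp (- a * u) / \<tau>\<close>. This is the slab at \<open>u + 1\<close>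
  up to the factor \<open>exp a / (a * \<omega> * \<tau>)\<close>, so the slab absorbs the shift of the spike as well as
  its own.
\<close>

lemma ssl_unit_shift:
  assumes "0 < a" "0 < \<tau>" "\<tau> \<le> 1 / a" "0 < \<omega>" "\<omega> \<le> 1" "0 < u"
  shows "ssl_mixing_density a \<tau> \<omega> u
    \<le> exp a * (1 + 1 / (a * \<omega> * \<tau>)) * ssl_mixing_density a \<tau> \<omega> (u + 1)"
proof -
  have "a \<le> 1 / \<tau>" using assms by (simp add: field_simps)
  then have "exp (- u / \<tau>) \<le> exp (- a * u)"
    using mult_right_mono[of a "1 / \<tau>" u] assms by simp
  then have "(1 - \<omega>) * (1 / \<tau>) * exp (- u / \<tau>) \<le> 1 * (1 / \<tau>) * exp (- a * u)"
    using assms by (intro mult_mono) auto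
  then have "ssl_mixing_density a \<tau> \<omega> u \<le> (\<omega> * a + 1 / \<tau>) * exp (- a * u)"
    using assms by (simp add: ssl_mixing_density_def algebra_simps)
  also have "\<dots> = exp a * (1 + 1 / (a * \<omega> * \<tau>)) * (\<omega> * a * exp (- a * (u + 1)))"
    using assms by (simp add: field_simps exp_add exp_diff exp_minus)
  also have "\<dots> \<le> exp a * (1 + 1 / (a * \<omega> * \<tau>)) * ssl_mixing_density a \<tau> \<omega> (u + 1)"
    using assms by (intro mult_left_mono) (auto simp: ssl_mixing_density_def)
  finally show ?thesis .
qed

text \<open>
  The four smallness conditions on \<open>\<rho>\<close> have separate purposes: the first makes \<open>L \<ge> 1\<close>, so that
  constants and \<open>sqrt L\<close> are dominated by \<open>L\<close>; the next two bound the spike and the slab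
  contribution to the prior variance by \<open>1\<close> in total; the last makes the spike
  narrower than the slab.
\<close>

lemma ssl_sparse_risk:
  fixes n :: nat and p a \<alpha> K \<omega> :: real
  defines "\<rho> \<equiv> p / real n" and "L \<equiv> ln (real n / p)"
  defines "\<pi> \<equiv> ssl_mixing_density a (\<rho> powr \<alpha>) \<omega>"
  assumes p: "0 < p" "p < real n" and a: "0 < a" and \<alpha>: "1 \<le> \<alpha>" and K: "1 < K"
    and \<omega>: "\<rho> powr K \<le> \<omega>" "\<omega> \<le> \<rho> * sqrt L" "\<omega> \<le> 1 / 2"
    and small: "\<rho> \<le> exp (- 1)" "\<rho> \<le> 1 / 4" "\<rho> \<le> a\<^sup>2 / 4" "\<rho> \<le> 1 / a"
    and sparse: "\<theta>0 \<in> sparse_vectors n p"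
  shows "mixing_density \<pi>"
    and "(\<integral>\<^sup>+x. (\<Sum>i\<in>{1..n}. risk1 \<pi> (\<theta>0 i) (x i)) \<partial>obs_law n \<theta>0)
      \<le> ennreal ((12 + 8 * a + 10 / a + 8 * (K + \<alpha>)) * (p * L))"
proof -
  define \<tau> where "\<tau> = \<rho> powr \<alpha>"
  have n: "0 < real n" using p by linarith
  have \<rho>: "0 < \<rho>" "\<rho> < 1" using p n by (auto simp: \<rho>_def)
  have L_eq: "L = - ln \<rho>" using p n by (simp add: L_def \<rho>_def ln_div)
  have L: "1 \<le> L"
  proof -
    have "ln \<rho> \<le> ln (exp (- 1))" using small(1) \<rho> by (subst ln_le_cancel_iff) auto
    then show ?thesis by (simp add: L_eq)
  qed
  have \<tau>: "0 < \<tau>" "\<tau> \<le> \<rho>"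
    using \<rho> \<alpha> powr_mono'[of 1 \<alpha> \<rho>] by (auto simp: \<tau>_def)
  have \<omega>_pos: "0 < \<omega>" using \<omega>(1) \<rho> by (auto intro: less_le_trans[of _ "\<rho> powr K"])
  show mix: "mixing_density \<pi>"
    unfolding \<pi>_def \<tau>_def[symmetric] using a \<tau> \<omega>_pos \<omega>(3) by (intro mixing_density_ssl) auto
  interpret mixing_density \<pi> by (rule mix)
  define v where "v = \<omega> / a + \<tau>"
  define D where "D = exp a * (1 + 1 / (a * \<omega> * \<tau>))"
  have "(\<integral>\<^sup>+u. ennreal (\<pi> u) * ennreal u \<partial>lborel) = ennreal (\<omega> / a + (1 - \<omega>) * \<tau>)"
    unfolding \<pi>_def \<tau>_def[symmetric]
    using ssl_moment[of a \<tau> \<omega> 1] a \<tau> \<omega>_pos \<omega>(3) by simp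
  also have "\<dots> \<le> ennreal v"
    using \<omega>_pos \<tau> by (intro ennreal_leI) (simp add: v_def)
  finally have mean: "(\<integral>\<^sup>+u. ennreal (\<pi> u) * ennreal u \<partial>lborel) \<le> ennreal v" .
  have v0: "0 \<le> v" using a \<tau> \<omega>_pos by (simp add: v_def)
  have v1: "v \<le> 1"
  proof -
    \<comment> \<open>\<open>\<rho> * sqrt L\<close> tends to \<open>0\<close> because the logarithm grows slower than \<open>1 / \<rho>\<close>.\<close>
    have "L \<le> 1 / \<rho>"
      using ln_bound[of "1 / \<rho>"] \<rho> by (simp add: L_eq ln_div)
    then have "\<rho> * sqrt L \<le> \<rho> * sqrt (1 / \<rho>)" using \<rho> by (intro mult_left_mono) auto
    also have "\<dots> = sqrt \<rho>" using \<rho> by (simp add: real_sqrt_divide real_div_sqrt)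
    also have "\<dots> \<le> a / 2"
      using small(3) a by (intro real_le_lsqrt) (auto simp: power_divide)
    finally have "\<omega> / a \<le> 1 / 2" using \<omega>(2) a by (simp add: field_simps)
    then show ?thesis using \<tau> small(2) by (simp add: v_def)
  qed
  have D1: "1 \<le> D"
  proof -
    have "1 * 1 \<le> D" unfolding D_def using a \<tau> \<omega>_pos by (intro mult_mono) auto
    then show ?thesis by simp
  qed
  have shift: "\<pi> u \<le> D * \<pi> (u + 1)" if "0 < u" for u
    unfolding \<pi>_def D_def \<tau>_def[symmetric]
    using a \<tau> \<omega>_pos \<omega>(3) small(4) that by (intro ssl_unit_shift) auto
  have ln_D: "ln (sqrt 2 * D) \<le> (1 + a + 1 / a + K + \<alpha>) * L"
  proof -
    have "\<rho> powr (K + \<alpha>) \<le> \<omega> * \<tau>"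
      unfolding powr_add \<tau>_def using \<omega> by (intro mult_right_mono) auto
    then have "1 / (\<omega> * \<tau>) \<le> 1 / \<rho> powr (K + \<alpha>)"
      using \<rho> by (intro divide_left_mono mult_pos_pos) (auto simp: \<omega>_pos \<tau>)
    also have "\<dots> = exp ((K + \<alpha>) * L)"
      using \<rho> by (simp add: powr_def L_eq exp_minus inverse_eq_divide)
    finally have inv: "1 / a * (1 / (\<omega> * \<tau>)) \<le> 1 / a * exp ((K + \<alpha>) * L)"
      using a by (intro mult_left_mono) auto
    have "1 \<le> exp ((K + \<alpha>) * L)" using K \<alpha> L by simp
    then have "1 + 1 / a * (1 / (\<omega> * \<tau>)) \<le> exp ((K + \<alpha>) * L) + 1 / a * exp ((K + \<alpha>) * L)"
      using inv by (rule add_mono)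
    then have "1 + 1 / (a * \<omega> * \<tau>) \<le> (1 + 1 / a) * exp ((K + \<alpha>) * L)"
      by (simp only: distrib_right mult_1_left times_divide_times_eq mult.assoc)
    also have "\<dots> \<le> exp (1 / a) * exp ((K + \<alpha>) * L)"
      by (intro mult_right_mono) (auto simp: exp_ge_add_one_self)
    finally have "D \<le> exp a * (exp (1 / a) * exp ((K + \<alpha>) * L))"
      unfolding D_def by (intro mult_left_mono) auto
    moreover have "sqrt 2 \<le> exp 1"
      using exp_ge_add_one_self[of 1] real_le_lsqrt[of 2 2] by simp
    ultimately have "sqrt 2 * D \<le> exp 1 * (exp a * (exp (1 / a) * exp ((K + \<alpha>) * L)))"
      using D1 by (intro mult_mono) auto
    also have "\<dots> = exp (1 + a + 1 / a + (K + \<alpha>) * L)" by (simp add: exp_add)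
    finally have "ln (sqrt 2 * D) \<le> ln (exp (1 + a + 1 / a + (K + \<alpha>) * L))"
      using D1 by (subst ln_le_cancel_iff) auto
    also have "\<dots> = (1 + a + 1 / a) * 1 + (K + \<alpha>) * L" by simp
    also have "\<dots> \<le> (1 + a + 1 / a) * L + (K + \<alpha>) * L"
      using L a by (intro add_right_mono mult_left_mono) auto
    finally show ?thesis by (simp add: algebra_simps)
  qed
  have v_bound: "real n * v \<le> p * ((1 / a + 1) * L)"
  proof -
    have "sqrt L \<le> L" using L by (intro real_le_lsqrt) (auto simp: power2_eq_square)
    then have "\<rho> * sqrt L \<le> \<rho> * L" using \<rho> by (intro mult_left_mono) auto
    then have "\<omega> / a \<le> \<rho> * L / a" using \<omega>(2) a by (intro divide_right_mono) auto
    moreover have "\<rho> * 1 \<le> \<rho> * L" using \<rho> L by (intro mult_left_mono) auto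
    then have "\<tau> \<le> \<rho> * L" using \<tau>(2) by linarith
    ultimately have "v \<le> \<rho> * ((1 / a + 1) * L)" by (simp add: v_def algebra_simps)
    then have "real n * v \<le> real n * (\<rho> * ((1 / a + 1) * L))" using n by (intro mult_left_mono) auto
    then show ?thesis using n by (simp add: \<rho>_def)
  qed
  have "2 * real n * v + p * (8 * ln (sqrt 2 * D) + 2)
      \<le> 2 * (p * ((1 / a + 1) * L)) + p * (8 * ((1 + a + 1 / a + K + \<alpha>) * L) + 2 * L)"
    using v_bound ln_D L p by (intro add_mono mult_left_mono) auto
  also have "\<dots> = (12 + 8 * a + 10 / a + 8 * (K + \<alpha>)) * (p * L)"
    by (simp add: algebra_simps)
  finally show "(\<integral>\<^sup>+x. (\<Sum>i\<in>{1..n}. risk1 \<pi> (\<theta>0 i) (x i)) \<partial>obs_law n \<theta>0)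
      \<le> ennreal ((12 + 8 * a + 10 / a + 8 * (K + \<alpha>)) * (p * L))"
    by (intro order_trans[OF sparse_risk[OF mean v0 v1 D1 shift sparse]] ennreal_leI)
qed

section \<open>Contraction rate and risk over sparse vectors\<close>

theorem mainTheorem6:
  fixes p \<tau> \<omega> :: "nat \<Rightarrow> real" and a \<alpha> K :: real
    and \<pi> :: "nat \<Rightarrow> real \<Rightarrow> real"
  assumes "\<forall>\<^sub>F n in sequentially. 0 < p n \<and> p n < real n"
    and "p \<in> o(\<lambda>n. real n)"
    and "0 < a"
    and "1 \<le> \<alpha>" and "\<And>n. \<tau> n = (p n / real n) powr \<alpha>"
    and "1 < K"
    and "\<forall>\<^sub>F n in sequentially.
           (p n / real n) powr K \<le> \<omega> n
           \<and> \<omega> n \<le> p n / real n * sqrt (ln (real n / p n))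
           \<and> p n / real n * sqrt (ln (real n / p n)) \<le> 1 / 2"
    and "\<And>n. \<pi> n = ssl_mixing_density a (\<tau> n) (\<omega> n)"
  shows
    "(\<forall>M :: nat \<Rightarrow> real. (\<forall>n. 0 < M n) \<and> filterlim M at_top sequentially \<longrightarrow>
        (\<lambda>n. SUP \<theta>0\<in>sparse_vectors n (p n).
           \<integral>\<^sup>+x. emeasure (posterior n (\<pi> n) x)
                    {\<theta> \<in> space (posterior n (\<pi> n) x).
                       (vec_dist n \<theta> \<theta>0)\<^sup>2 > M n * p n * ln (real n / p n)}
             \<partial>obs_law n \<theta>0) \<longlonglongrightarrow> 0)
     \<and> (\<exists>C0>0. \<forall>\<^sub>F n in sequentially.
        (SUP \<theta>0\<in>sparse_vectors n (p n).
           \<integral>\<^sup>+x. ennreal ((vec_dist n (posterior_mean n (\<pi> n) x) \<theta>0)\<^sup>2) \<partial>obs_law n \<theta>0)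
        \<le> ennreal (C0 * (p n * ln (real n / p n))))"
proof -
  define C where "C = 12 + 8 * a + 10 / a + 8 * (K + \<alpha>)"
  have C: "0 < C" using assms(3,4,6) by (simp add: C_def add_pos_pos)
  have ratio: "(\<lambda>n. p n / real n) \<longlonglongrightarrow> 0" using smalloD_tendsto[OF assms(2)] by simp
  have small: "\<forall>\<^sub>F n in sequentially. p n / real n \<le> Min {exp (- 1), 1 / 4, a\<^sup>2 / 4, 1 / a}"
  proof -
    have "0 < Min {exp (- 1), 1 / 4, a\<^sup>2 / 4, 1 / a}" using assms(3) by simp
    from order_tendstoD(2)[OF ratio this] show ?thesis by eventually_elim (rule less_imp_le)
  qed
  define good where "good n \<longleftrightarrow> 1 \<le> n \<and> 0 < p n \<and> 0 < ln (real n / p n) \<and>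
    (\<forall>\<theta>0\<in>sparse_vectors n (p n). mixing_density (\<pi> n) \<and>
      (\<integral>\<^sup>+x. (\<Sum>i\<in>{1..n}. risk1 (\<pi> n) (\<theta>0 i) (x i)) \<partial>obs_law n \<theta>0)
        \<le> ennreal (C * (p n * ln (real n / p n))))" for n
  have good: "\<forall>\<^sub>F n in sequentially. good n"
    using assms(1,7) small
  proof eventually_elim
    case (elim n)
    have "\<pi> n = ssl_mixing_density a ((p n / real n) powr \<alpha>) (\<omega> n)"
      using assms(5,8) by simp
    moreover have "0 < ln (real n / p n)" using elim(1) by (simp add: ln_gt_zero)
    moreover have "1 \<le> n" using elim(1) by (cases n) auto
    ultimately show ?case
      unfolding good_def C_def
      using ssl_sparse_risk[of "p n" n a \<alpha> K "\<omega> n"] elim assms(3,4,6) by auto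
  qed
  have "(\<lambda>n. SUP \<theta>0\<in>sparse_vectors n (p n).
           \<integral>\<^sup>+x. emeasure (posterior n (\<pi> n) x)
                    {\<theta> \<in> space (posterior n (\<pi> n) x).
                       (vec_dist n \<theta> \<theta>0)\<^sup>2 > M n * p n * ln (real n / p n)}
             \<partial>obs_law n \<theta>0) \<longlonglongrightarrow> 0"
    if M: "\<And>n. 0 < M n" "filterlim M at_top sequentially" for M :: "nat \<Rightarrow> real"
  proof (rule tendsto_sandwich[where f = "\<lambda>_. 0" and h = "\<lambda>n. ennreal (C / M n)"])
    have "((\<lambda>n. C / M n) \<longlongrightarrow> 0) sequentially"
      using M(2) by (rule real_tendsto_divide_at_top[OF tendsto_const])
    then show "(\<lambda>n. ennreal (C / M n)) \<longlonglongrightarrow> 0"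
      using tendsto_ennrealI by fastforce
    show "\<forall>\<^sub>F n in sequentially. (SUP \<theta>0\<in>sparse_vectors n (p n).
           \<integral>\<^sup>+x. emeasure (posterior n (\<pi> n) x)
                    {\<theta> \<in> space (posterior n (\<pi> n) x).
                       (vec_dist n \<theta> \<theta>0)\<^sup>2 > M n * p n * ln (real n / p n)}
             \<partial>obs_law n \<theta>0) \<le> ennreal (C / M n)"
      using good
    proof eventually_elim
      case (elim n)
      show ?case
      proof (rule SUP_least)
        fix \<theta>0 assume \<theta>0: "\<theta>0 \<in> sparse_vectors n (p n)"
        interpret mixing_density "\<pi> n" using elim \<theta>0 by (auto simp: good_def)
        define r where "r = p n * ln (real n / p n)"
        have r: "0 < r" using elim by (simp add: good_def r_def)
        have c: "0 < M n * p n * ln (real n / p n)" "M n * p n * ln (real n / p n) = M n * r"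
          using r M(1)[of n] by (simp_all add: r_def mult.assoc)
        have "(\<integral>\<^sup>+x. emeasure (posterior n (\<pi> n) x)
                    {\<theta> \<in> space (posterior n (\<pi> n) x).
                       (vec_dist n \<theta> \<theta>0)\<^sup>2 > M n * p n * ln (real n / p n)} \<partial>obs_law n \<theta>0)
            \<le> (\<integral>\<^sup>+x. ennreal (1 / (M n * r)) * (\<Sum>i\<in>{1..n}. risk1 (\<pi> n) (\<theta>0 i) (x i)) \<partial>obs_law n \<theta>0)"
          unfolding c(2)[symmetric] by (intro nn_integral_mono posterior_tail_bound c(1))
        also have "\<dots> = ennreal (1 / (M n * r)) *
            (\<integral>\<^sup>+x. (\<Sum>i\<in>{1..n}. risk1 (\<pi> n) (\<theta>0 i) (x i)) \<partial>obs_law n \<theta>0)"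
          by (rule nn_integral_cmult) measurable
        also have "\<dots> \<le> ennreal (1 / (M n * r)) * ennreal (C * r)"
          using elim \<theta>0 by (intro mult_left_mono) (auto simp: good_def r_def)
        also have "\<dots> = ennreal (C / M n)"
          using r M(1)[of n] C by (simp add: ennreal_mult'[symmetric])
        finally show "(\<integral>\<^sup>+x. emeasure (posterior n (\<pi> n) x)
                    {\<theta> \<in> space (posterior n (\<pi> n) x).
                       (vec_dist n \<theta> \<theta>0)\<^sup>2 > M n * p n * ln (real n / p n)} \<partial>obs_law n \<theta>0)
            \<le> ennreal (C / M n)" .
      qed
    qed
  qed auto
  moreover have "\<forall>\<^sub>F n in sequentially.
        (SUP \<theta>0\<in>sparse_vectors n (p n).
           \<integral>\<^sup>+x. ennreal ((vec_dist n (posterior_mean n (\<pi> n) x) \<theta>0)\<^sup>2) \<partial>obs_law n \<theta>0)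
        \<le> ennreal (C * (p n * ln (real n / p n)))"
    using good
  proof eventually_elim
    case (elim n)
    show ?case
    proof (rule SUP_least)
      fix \<theta>0 assume \<theta>0: "\<theta>0 \<in> sparse_vectors n (p n)"
      interpret mixing_density "\<pi> n" using elim \<theta>0 by (auto simp: good_def)
      have "(\<integral>\<^sup>+x. ennreal ((vec_dist n (posterior_mean n (\<pi> n) x) \<theta>0)\<^sup>2) \<partial>obs_law n \<theta>0)
          \<le> (\<integral>\<^sup>+x. (\<Sum>i\<in>{1..n}. risk1 (\<pi> n) (\<theta>0 i) (x i)) \<partial>obs_law n \<theta>0)"
        using elim by (intro nn_integral_mono posterior_mean_square_loss) (auto simp: good_def)
      also have "\<dots> \<le> ennreal (C * (p n * ln (real n / p n)))"
        using elim \<theta>0 by (auto simp: good_def)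
      finally show "(\<integral>\<^sup>+x. ennreal ((vec_dist n (posterior_mean n (\<pi> n) x) \<theta>0)\<^sup>2) \<partial>obs_law n \<theta>0)
          \<le> ennreal (C * (p n * ln (real n / p n)))" .
    qed
  qed
  ultimately show ?thesis using C by blast
qed

end
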